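(* Let $X_1,\dots,X_n$ be i.i.d. with distribution $P_0$ on $\mathbb{X}$, let $\{P_\theta:\theta\in\Theta\}$ be a statistical model (not necessarily containing $P_0$), let $\pi$ be a prior distribution on $\Theta$, let $\mathcal{F}$ be a variational set of probability distributions on $\Theta$, let $\beta>0$ be a temperature parameter, and let $\theta^*=\arg\min_{\theta\in\Theta}\mathbb{D}_k(P_\theta,P_0)$. Consider the following two conditions. Extended prior mass condition: there exists a distribution $\rho_n\in\mathcal{F}$ such that $$\int\mathbb{D}_k^2(P_\theta,P_{\theta^*})\,\rho_n(d\theta)\le\frac1n\quad\text{and}\quad \mathrm{KL}(\rho_n\|\pi)\le\frac{\beta}{n}.$$ Prior mass condition $C(\pi,\beta)$: $\pi(\mathcal{B}_n)\ge e^{-\beta/n}$, where $\mathcal{B}_n=\{\theta\in\Theta:\mathbb{D}_k(P_\theta,P_{\theta^*})\le n^{-1/2}\}$. (1) Under the extended prior mass condition, the variational approximation $\tilde\pi_n^\beta$ satisfies $$\mathbb{E}\left[\int\mathbb{D}_k^2(P_\theta,P_0)\,\tilde\pi_n^\beta(d\theta)\right]\le 8\inf_{\theta\in\Theta}\mathbb{D}_k^2(P_\theta,P_0)+\frac{16}{n},$$ where the expectation is with respect to the sample $X_1,\dots,X_n$. (2) Moreover, if the model is well-specified, i.e. $P_0\in\{P_\theta:\theta\in\Theta\}$, then under the prior mass condition $C(\pi,\beta)$, we have in probability, for any $M_n\to+\infty$, $$\tilde\pi_n^\beta\left(\mathbb{D}_k(P_\theta,P_0)>M_n\cdot n^{-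1/2}\right)\xrightarrow[n\to+\infty]{}0.$$
   Context: $(\mathbb{X},\mathcal{X})$ is a measurable space, and $k$ is an integrally strictly positive definite kernel on $\mathbb{X}$, meaning that $k$ is a positive definite kernel satisfying $\mathbb{E}_{X,Y\sim P}[k(X,Y)]\neq0$ for any distribution $P$; $k$ is bounded by $1$. $\mathcal{H}_k$ is the associated reproducing kernel Hilbert space, with the reproducing property $f(x)=\langle f,k(x,\cdot)\rangle_{\mathcal{H}_k}$ for $f\in\mathcal{H}_k$, $x\in\mathbb{X}$. The kernel mean embedding of a probability distribution $P$ on $\mathbb{X}$ is $\mu_P(\cdot)=\mathbb{E}_{X\sim P}[k(X,\cdot)]\in\mathcal{H}_k$, and the Maximum Mean Discrepancy between $P$ and $Q$ is $\mathbb{D}_k(P,Q)=\|\mu_P-\mu_Q\|_{\mathcal{H}_k}$. Under the assumptions made on the kernel, the paper takes the kernel mean embedding to be injective and $\mathbb{D}_k$ to be a metric. $P_0$ is the data-generating distribution on $\mathbb{X}$. The parameter space $\Theta$ is equipped with a sigma-algebra, and each $P_\theta$, $\theta\in\Theta$, is a probability distribution on $\mathbb{X}$. The empirical measure is $\hat P_n=\frac1n\sum_{i=1}^n\delta_{X_i}$. The MMD-Bayes pseudo-posterior with prior $\pi$ and temperature $\beta>0$ (which may be chosen depending on $n$) is the random probability distribution on $\Theta$ $$\pi_n^\beta(d\theta)\propto\exp\left(-\beta\,\mathbb{D}_k^2(P_\theta,\hat P_n)\right)\pi(d\theta).$$ $\mathrm{KL}(\cdot\|\cdot)$ denotes the Kullback-Leibler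 divergence. The variational approximation of $\pi_n^\beta$ in $\mathcal{F}$ is $$\tilde\pi_n^\beta=\arg\min_{\rho\in\mathcal{F}}\mathrm{KL}(\rho\|\pi_n^\beta).$$
   Formalization: In part (2) the extended prior mass condition is assumed for every n ≥ 1 in addition to C(π,β); with C(π,β) alone the claim fails, e.g. when F consists of a single distribution concentrated away from θ*. *)

theory Defs
  imports "HOL-Probability.Probability"
begin

definition positive_definite_kernel :: "'x set \<Rightarrow> ('x \<Rightarrow> 'x \<Rightarrow> real) \<Rightarrow> bool" where
  "positive_definite_kernel S k \<longleftrightarrow>
     (\<forall>x\<in>S. \<forall>y\<in>S. k x y = k y x) \<and>
     (\<forall>A c. finite A \<and> A \<subseteq> S \<longrightarrow> 0 \<le> (\<Sum>x\<in>A. \<Sum>y\<in>A. c x * c y * k x y))"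

definition integrally_strictly_positive_definite ::
    "'x measure \<Rightarrow> ('x \<Rightarrow> 'x \<Rightarrow> real) \<Rightarrow> bool" where
  "integrally_strictly_positive_definite X k \<longleftrightarrow>
     positive_definite_kernel (space X) k \<and>
     (\<forall>P\<in>space (prob_algebra X). (\<integral>z. k (fst z) (snd z) \<partial>(P \<Otimes>\<^sub>M P)) \<noteq> 0)"

(* A real function on the set S is encoded as a total function that vanishes outside S, so that
   equality of functions on S is plain equality. *)
definition kernel_section :: "'x set \<Rightarrow> ('x \<Rightarrow> 'x \<Rightarrow> real) \<Rightarrow> 'x \<Rightarrow> 'x \<Rightarrow> real" where
  "kernel_section S k x = (\<lambda>y. if y \<in> S then k x y else 0)"

definition ip_norm :: "(('x \<Rightarrow> real) \<Rightarrow> ('x \<Rightarrow> real) \<Rightarrow> real) \<Rightarrow> ('x \<Rightarrow> real) \<Rightarrow> real" where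
  "ip_norm ip f = sqrt (ip f f)"

(* (H, ip) is the reproducing kernel Hilbert space of k on S; by the Moore-Aronszajn theorem
   every positive definite kernel on S has exactly one (ip being determined on H only). *)
locale rkhs =
  fixes S :: "'x set"
    and k :: "'x \<Rightarrow> 'x \<Rightarrow> real"
    and H :: "('x \<Rightarrow> real) set"
    and ip :: "('x \<Rightarrow> real) \<Rightarrow> ('x \<Rightarrow> real) \<Rightarrow> real"
  assumes functions_on: "\<And>f x. f \<in> H \<Longrightarrow> x \<notin> S \<Longrightarrow> f x = 0"
    and zero_mem: "(\<lambda>x. 0) \<in> H"
    and add_mem: "\<And>f g. f \<in> H \<Longrightarrow> g \<in> H \<Longrightarrow> (\<lambda>x. f x + g x) \<in> H"
    and scale_mem: "\<And>c f. f \<in> H \<Longrightarrow> (\<lambda>x. c * f x) \<in> H"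
    and ip_sym: "\<And>f g. f \<in> H \<Longrightarrow> g \<in> H \<Longrightarrow> ip f g = ip g f"
    and ip_add: "\<And>f g h. f \<in> H \<Longrightarrow> g \<in> H \<Longrightarrow> h \<in> H \<Longrightarrow>
      ip (\<lambda>x. f x + g x) h = ip f h + ip g h"
    and ip_scale: "\<And>c f g. f \<in> H \<Longrightarrow> g \<in> H \<Longrightarrow> ip (\<lambda>x. c * f x) g = c * ip f g"
    and ip_nonneg: "\<And>f. f \<in> H \<Longrightarrow> 0 \<le> ip f f"
    and ip_definite: "\<And>f. f \<in> H \<Longrightarrow> ip f f = 0 \<Longrightarrow> f = (\<lambda>x. 0)"
    and complete: "\<And>s :: nat \<Rightarrow> 'x \<Rightarrow> real. (\<And>n. s n \<in> H) \<Longrightarrow>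
      (\<forall>e>0. \<exists>N. \<forall>m\<ge>N. \<forall>n\<ge>N. ip_norm ip (\<lambda>x. s m x - s n x) < e) \<Longrightarrow>
      (\<exists>f\<in>H. (\<lambda>n. ip_norm ip (\<lambda>x. s n x - f x)) \<longlonglongrightarrow> 0)"
    and kernel_mem: "\<And>x. x \<in> S \<Longrightarrow> kernel_section S k x \<in> H"
    and reproducing: "\<And>f x. f \<in> H \<Longrightarrow> x \<in> S \<Longrightarrow> ip f (kernel_section S k x) = f x"

definition mean_embedding ::
    "'x measure \<Rightarrow> ('x \<Rightarrow> 'x \<Rightarrow> real) \<Rightarrow> 'x measure \<Rightarrow> 'x \<Rightarrow> real" where
  "mean_embedding X k P = (\<lambda>y. \<integral>x. kernel_section (space X) k x y \<partial>P)"

definition mmd ::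
    "'x measure \<Rightarrow> ('x \<Rightarrow> 'x \<Rightarrow> real) \<Rightarrow> (('x \<Rightarrow> real) \<Rightarrow> ('x \<Rightarrow> real) \<Rightarrow> real) \<Rightarrow>
     'x measure \<Rightarrow> 'x measure \<Rightarrow> real" where
  "mmd X k ip P Q = ip_norm ip (\<lambda>y. mean_embedding X k P y - mean_embedding X k Q y)"

definition empirical_measure :: "'x measure \<Rightarrow> nat \<Rightarrow> (nat \<Rightarrow> 'x) \<Rightarrow> 'x measure" where
  "empirical_measure X n x =
     measure_of (space X) (sets X) (\<lambda>A. (\<Sum>i\<in>{1..n}. emeasure (return X (x i)) A) / of_nat n)"

(* KL rho pi is the divergence of rho from pi; KL_divergence takes the reference measure first.
   For probability measures with rho << pi the negative part of the log-density is always
   rho-integrable, so non-integrability means that the divergence is infinite. *)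
definition KL :: "'a measure \<Rightarrow> 'a measure \<Rightarrow> ereal" where
  "KL \<rho> \<pi> =
     (if absolutely_continuous \<pi> \<rho> \<and> integrable \<rho> (entropy_density (exp 1) \<pi> \<rho>)
      then ereal (KL_divergence (exp 1) \<pi> \<rho>) else \<infinity>)"

definition mmd_posterior ::
    "'x measure \<Rightarrow> ('x \<Rightarrow> 'x \<Rightarrow> real) \<Rightarrow> (('x \<Rightarrow> real) \<Rightarrow> ('x \<Rightarrow> real) \<Rightarrow> real) \<Rightarrow>
     ('t \<Rightarrow> 'x measure) \<Rightarrow> 't measure \<Rightarrow> real \<Rightarrow> 'x measure \<Rightarrow> 't measure" where
  "mmd_posterior X k ip P \<pi> \<beta> Q =
     density \<pi> (\<lambda>\<theta>. ennreal (exp (- \<beta> * (mmd X k ip (P \<theta>) Q)\<^sup>2) /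
                          (\<integral>\<theta>'. exp (- \<beta> * (mmd X k ip (P \<theta>') Q)\<^sup>2) \<partial>\<pi>)))"

definition variational_approximation :: "'t measure set \<Rightarrow> 't measure \<Rightarrow> 't measure \<Rightarrow> bool" where
  "variational_approximation F post \<rho> \<longleftrightarrow> is_arg_min (\<lambda>\<rho>. KL \<rho> post) (\<lambda>\<rho>. \<rho> \<in> F) \<rho>"

definition iid_sample ::
    "'w measure \<Rightarrow> 'x measure \<Rightarrow> 'x measure \<Rightarrow> nat set \<Rightarrow> (nat \<Rightarrow> 'w \<Rightarrow> 'x) \<Rightarrow> bool" where
  "iid_sample M X P0 I Xs \<longleftrightarrow>
     prob_space.indep_vars M (\<lambda>_. X) Xs I \<and> (\<forall>i\<in>I. distr M X (Xs i) = P0)"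

definition extended_prior_mass ::
    "'x measure \<Rightarrow> ('x \<Rightarrow> 'x \<Rightarrow> real) \<Rightarrow> (('x \<Rightarrow> real) \<Rightarrow> ('x \<Rightarrow> real) \<Rightarrow> real) \<Rightarrow>
     ('t \<Rightarrow> 'x measure) \<Rightarrow> 't \<Rightarrow> 't measure \<Rightarrow> 't measure set \<Rightarrow> nat \<Rightarrow> real \<Rightarrow> bool" where
  "extended_prior_mass X k ip P \<theta>s \<pi> F n \<beta> \<longleftrightarrow>
     (\<exists>\<rho>\<in>F. (\<integral>\<theta>. (mmd X k ip (P \<theta>) (P \<theta>s))\<^sup>2 \<partial>\<rho>) \<le> 1 / real n \<and>
            KL \<rho> \<pi> \<le> ereal (\<beta> / real n))"

definition prior_mass ::
    "'x measure \<Rightarrow> ('x \<Rightarrow> 'x \<Rightarrow> real) \<Rightarrow> (('x \<Rightarrow> real) \<Rightarrow> ('x \<Rightarrow> real) \<Rightarrow> real) \<Rightarrow>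
     ('t \<Rightarrow> 'x measure) \<Rightarrow> 't \<Rightarrow> 't measure \<Rightarrow> nat \<Rightarrow> real \<Rightarrow> bool" where
  "prior_mass X k ip P \<theta>s \<pi> n \<beta> \<longleftrightarrow>
     measure \<pi> {\<theta>\<in>space \<pi>. mmd X k ip (P \<theta>) (P \<theta>s) \<le> real n powr (- 1 / 2)}
       \<ge> exp (- \<beta> / real n)"

end

theory Submission
  imports Defs
begin

text \<open>
  Everything happens through the squared discrepancy, which is a squared Hilbert norm of a
  difference of mean embeddings. That the embeddings lie in \<open>H\<close> is the content of
  \<open>mean_embedding_represents\<close>: the embedding of \<open>Q\<close> is the Riesz representer of integration
  against \<open>Q\<close>. It follows that inner products of embeddings are integrals of the kernel, that the
  discrepancy is bounded and satisfies \<open>D(P,R)\<^sup>2 \<le> 2 * D(P,Q)\<^sup>2 + 2 * D(Q,R)\<^sup>2\<close>, and that the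
  empirical measure of \<open>n\<close> independent observations is on average within \<open>1 / n\<close> of its law in
  squared discrepancy, as an average of \<open>n\<close> independent centred vectors of second moment at most 1
  (\<open>expectation_mmd_empirical_le\<close>).

  The posterior is an exponential tilting of the prior, so \<open>KL \<rho> post\<close> equals
  \<open>KL \<rho> \<pi> + \<beta> * (\<integral>\<theta>. D(P \<theta>, E)\<^sup>2 \<partial>\<rho>)\<close> up to a constant, where \<open>E\<close> is the empirical measure
  (\<open>KL_exp_density\<close>). Comparing the variational approximation with the competitor supplied by the
  extended prior mass condition, whose divergence from the prior is at most \<open>\<beta> / n\<close>, bounds the
  empirical risk of the approximation by that of the competitor plus \<open>1 / n\<close>
  (\<open>variational_approximation_risk_le\<close>). Exchanging the empirical measure for \<open>P0\<close> on both sides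
  and taking expectations gives the risk bound.

  In the well-specified case the smallest discrepancy is zero, the risk at sample size \<open>n\<close> is at
  most \<open>16 / n\<close>, and Markov's inequality turns this into concentration at every rate slower than
  \<open>1 / sqrt n\<close> (\<open>contraction_in_probability\<close>).
\<close>

section \<open>Hilbert space geometry of a reproducing kernel space\<close>

context rkhs
begin

lemma diff_mem: "f \<in> H \<Longrightarrow> g \<in> H \<Longrightarrow> (\<lambda>x. f x - g x) \<in> H"
  using add_mem[of f "\<lambda>x. (-1) * g x"] scale_mem[of g "-1"] by simp

lemma ip_diff:
  assumes "f \<in> H" "g \<in> H" "h \<in> H"
  shows "ip (\<lambda>x. f x - g x) h = ip f h - ip g h"
  using ip_add[of f "\<lambda>x. (-1) * g x" h] ip_scale[of g h "-1"] scale_mem[of g "-1"] assms by simp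

lemma ip_add_right:
  assumes "f \<in> H" "g \<in> H" "h \<in> H"
  shows "ip h (\<lambda>x. f x + g x) = ip h f + ip h g"
  using ip_sym[OF assms(3) add_mem[OF assms(1,2)]] ip_add[OF assms]
    ip_sym[OF assms(1,3)] ip_sym[OF assms(2,3)] by linarith

lemma ip_diff_right:
  assumes "f \<in> H" "g \<in> H" "h \<in> H"
  shows "ip h (\<lambda>x. f x - g x) = ip h f - ip h g"
  using ip_sym[OF assms(3) diff_mem[OF assms(1,2)]] ip_diff[OF assms]
    ip_sym[OF assms(1,3)] ip_sym[OF assms(2,3)] by linarith

lemma ip_scale_right:
  assumes "f \<in> H" "h \<in> H"
  shows "ip h (\<lambda>x. c * f x) = c * ip h f"
  using ip_sym[OF assms(2) scale_mem[OF assms(1)]] ip_scale[OF assms]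
    ip_sym[OF assms] by simp

lemma ip_norm_nonneg: "f \<in> H \<Longrightarrow> 0 \<le> ip_norm ip f"
  by (simp add: ip_norm_def ip_nonneg)

lemma ip_norm_power2: "f \<in> H \<Longrightarrow> (ip_norm ip f)\<^sup>2 = ip f f"
  by (simp add: ip_norm_def ip_nonneg)

lemma ip_self_add:
  assumes "f \<in> H" "g \<in> H"
  shows "ip (\<lambda>x. f x + g x) (\<lambda>x. f x + g x) = ip f f + 2 * ip f g + ip g g"
  using assms by (simp add: ip_add ip_add_right add_mem ip_sym[of g f])

lemma ip_self_diff:
  assumes "f \<in> H" "g \<in> H"
  shows "ip (\<lambda>x. f x - g x) (\<lambda>x. f x - g x) = ip f f - 2 * ip f g + ip g g"
  using assms by (simp add: ip_diff ip_diff_right diff_mem ip_sym[of g f])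

lemma ip_self_add_le:
  assumes "f \<in> H" "g \<in> H"
  shows "ip (\<lambda>x. f x + g x) (\<lambda>x. f x + g x) \<le> 2 * ip f f + 2 * ip g g"
  using ip_self_add[OF assms] ip_self_diff[OF assms] ip_nonneg[OF diff_mem[OF assms]] by linarith

lemma Cauchy_Schwarz_power2:
  assumes f: "f \<in> H" and g: "g \<in> H"
  shows "(ip f g)\<^sup>2 \<le> ip f f * ip g g"
proof -
  have quad: "0 \<le> ip f f + 2 * t * ip f g + t\<^sup>2 * ip g g" for t
  proof -
    have "0 \<le> ip (\<lambda>x. f x + t * g x) (\<lambda>x. f x + t * g x)"
      by (intro ip_nonneg add_mem scale_mem f g)
    also have "\<dots> = ip f f + 2 * t * ip f g + t\<^sup>2 * ip g g"
      using f g by (simp add: ip_self_add scale_mem ip_scale ip_scale_right power2_eq_square)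
    finally show ?thesis .
  qed
  show ?thesis
  proof (cases "ip g g = 0")
    case True
    then have "g = (\<lambda>x. 0)" using g ip_definite by blast
    then show ?thesis using ip_scale_right[of f f 0] f True by simp
  next
    case False
    then have pos: "ip g g > 0" using ip_nonneg[OF g] by linarith
    show ?thesis
      using quad[of "- ip f g / ip g g"] pos by (simp add: field_simps power2_eq_square)
  qed
qed

lemma Cauchy_Schwarz:
  assumes "f \<in> H" "g \<in> H"
  shows "\<bar>ip f g\<bar> \<le> ip_norm ip f * ip_norm ip g"
  using real_sqrt_le_mono[OF Cauchy_Schwarz_power2[OF assms]]
  by (simp add: ip_norm_def real_sqrt_mult)

lemma eval_bound:
  assumes f: "f \<in> H" and x: "x \<in> S"
  shows "\<bar>f x\<bar> \<le> ip_norm ip f * sqrt (k x x)"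
proof -
  have "ip (kernel_section S k x) (kernel_section S k x) = k x x"
    using reproducing[OF kernel_mem[OF x] x] x by (simp add: kernel_section_def)
  then show ?thesis
    using Cauchy_Schwarz[OF f kernel_mem[OF x]] reproducing[OF f x] by (simp add: ip_norm_def)
qed

text \<open>
  The representer is the minimiser of the energy \<open>J f = ip f f - 2 * L f\<close> over \<open>V\<close>. The
  parallelogram identity makes a minimising sequence Cauchy; its limit \<open>f\<close> satisfies
  \<open>J f \<le> J (f + t h)\<close> for every direction \<open>h\<close> and every real \<open>t\<close>, and the vanishing of the term
  linear in \<open>t\<close> is the claim.
\<close>
theorem Riesz_representation_subspace:
  assumes V: "V \<subseteq> H" "(\<lambda>x. 0) \<in> V"
    and V_add: "\<And>f g. f \<in> V \<Longrightarrow> g \<in> V \<Longrightarrow> (\<lambda>x. f x + g x) \<in> V"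
    and V_scale: "\<And>c f. f \<in> V \<Longrightarrow> (\<lambda>x. c * f x) \<in> V"
    and V_closed: "\<And>s f. (\<And>n::nat. s n \<in> V) \<Longrightarrow> f \<in> H \<Longrightarrow>
      (\<lambda>n. ip_norm ip (\<lambda>x. s n x - f x)) \<longlonglongrightarrow> 0 \<Longrightarrow> f \<in> V"
    and L_add: "\<And>f g. f \<in> V \<Longrightarrow> g \<in> V \<Longrightarrow> L (\<lambda>x. f x + g x) = L f + L g"
    and L_scale: "\<And>c f. f \<in> V \<Longrightarrow> L (\<lambda>x. c * f x) = c * L f"
    and L_bounded: "\<And>f. f \<in> V \<Longrightarrow> \<bar>L f\<bar> \<le> C * ip_norm ip f"
  shows "\<exists>f\<in>V. \<forall>h\<in>V. ip f h = L h"
proof -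
  define J where "J f = ip f f - 2 * L f" for f
  define m where "m = (INF f\<in>V. J f)"
  have H: "f \<in> H" if "f \<in> V" for f using that V by blast
  have "- C\<^sup>2 \<le> J f" if f: "f \<in> V" for f
  proof -
    have "L f \<le> C * ip_norm ip f" using L_bounded[OF f] by linarith
    moreover have "0 \<le> (ip_norm ip f - C)\<^sup>2" by simp
    ultimately show ?thesis
      using ip_norm_power2[OF H[OF f]] by (simp add: J_def power2_diff algebra_simps)
  qed
  then have bdd: "bdd_below (J ` V)" by (intro bdd_belowI2)
  have m_le: "m \<le> J f" if "f \<in> V" for f unfolding m_def by (rule cINF_lower[OF bdd that])
  have "\<exists>f\<in>V. J f < m + inverse (real (Suc n))" for n
    using cINF_less_iff[OF _ bdd, of "m + inverse (real (Suc n))"] V(2) by (auto simp: m_def)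
  then obtain s where s: "s n \<in> V" and sJ: "J (s n) < m + inverse (real (Suc n))" for n
    by metis
  have close: "(ip_norm ip (\<lambda>x. s i x - s j x))\<^sup>2
      \<le> 2 * inverse (real (Suc i)) + 2 * inverse (real (Suc j))" for i j
  proof -
    define p where "p = (\<lambda>x. s i x + s j x)"
    have p: "p \<in> V" unfolding p_def by (rule V_add[OF s s])
    have "m \<le> J (\<lambda>x. (1/2) * p x)" by (rule m_le[OF V_scale[OF p]])
    also have "\<dots> = ip p p / 4 - L p"
      using p H[OF p] L_scale[OF p, of "1/2"] ip_scale[OF H[OF p] H[OF V_scale[OF p]], of "1/2" "1/2"]
        ip_scale_right[OF H[OF p] H[OF p], of "1/2"] unfolding J_def by simp
    finally have "4 * m \<le> ip p p - 4 * (L (s i) + L (s j))"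
      using L_add[OF s s, of i j] by (simp add: p_def)
    moreover have "ip p p = ip (s i) (s i) + 2 * ip (s i) (s j) + ip (s j) (s j)"
      unfolding p_def by (rule ip_self_add[OF H[OF s] H[OF s]])
    moreover have "(ip_norm ip (\<lambda>x. s i x - s j x))\<^sup>2
        = ip (s i) (s i) - 2 * ip (s i) (s j) + ip (s j) (s j)"
      using ip_norm_power2[OF diff_mem[OF H[OF s] H[OF s]], of i j] ip_self_diff[OF H[OF s] H[OF s], of i j] by simp
    moreover have "ip (s i) (s i) - 2 * L (s i) < m + inverse (real (Suc i))"
      "ip (s j) (s j) - 2 * L (s j) < m + inverse (real (Suc j))"
      using sJ[of i] sJ[of j] unfolding J_def by simp_all
    ultimately show ?thesis by argo
  qed
  have "\<exists>f\<in>H. (\<lambda>n. ip_norm ip (\<lambda>x. s n x - f x)) \<longlonglongrightarrow> 0"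
  proof (rule complete)
    show "s n \<in> H" for n by (rule H[OF s])
    show "\<forall>e>0. \<exists>N. \<forall>i\<ge>N. \<forall>j\<ge>N. ip_norm ip (\<lambda>x. s i x - s j x) < e"
    proof (intro allI impI)
      fix e :: real assume e: "0 < e"
      then obtain N where N: "inverse (real (Suc N)) < e\<^sup>2 / 4"
        using reals_Archimedean[of "e\<^sup>2 / 4"] by auto
      have "ip_norm ip (\<lambda>x. s i x - s j x) < e" if "i \<ge> N" "j \<ge> N" for i j
      proof (rule power2_less_imp_less)
        have "inverse (real (Suc i)) \<le> inverse (real (Suc N))"
          "inverse (real (Suc j)) \<le> inverse (real (Suc N))"
          using that by (auto intro!: le_imp_inverse_le)
        then show "(ip_norm ip (\<lambda>x. s i x - s j x))\<^sup>2 < e\<^sup>2"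
          using close[of i j] N by linarith
      qed (use e in simp)
      then show "\<exists>N. \<forall>i\<ge>N. \<forall>j\<ge>N. ip_norm ip (\<lambda>x. s i x - s j x) < e" by blast
    qed
  qed
  then obtain f where f: "f \<in> H" and lim: "(\<lambda>n. ip_norm ip (\<lambda>x. s n x - f x)) \<longlonglongrightarrow> 0"
    by blast
  have fV: "f \<in> V" by (rule V_closed[OF s f lim])
  have "ip f h = L h" if h: "h \<in> V" for h
  proof -
    have ip_lim: "(\<lambda>n. ip (s n) h) \<longlonglongrightarrow> ip f h"
    proof -
      have null: "(\<lambda>n. ip_norm ip (\<lambda>x. s n x - f x) * ip_norm ip h) \<longlonglongrightarrow> 0"
        using tendsto_mult_right[OF lim, of "ip_norm ip h"] by simp
      have "norm (ip (s n) h - ip f h) \<le> ip_norm ip (\<lambda>x. s n x - f x) * ip_norm ip h" for n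
        using Cauchy_Schwarz[OF diff_mem[OF H[OF s] f] H[OF h], of n] ip_diff[OF H[OF s] f H[OF h], of n]
        by simp
      then show ?thesis
        by (intro LIM_zero_cancel[OF Lim_null_comparison[OF always_eventually null]] allI)
    qed
    have perturb: "0 \<le> 2 * t * (ip f h - L h) + t\<^sup>2 * ip h h" for t
    proof -
      have "m \<le> J (s n) + 2 * t * (ip (s n) h - L h) + t\<^sup>2 * ip h h" for n
      proof -
        have "m \<le> J (\<lambda>x. s n x + t * h x)" by (intro m_le V_add V_scale s h)
        also have "\<dots> = J (s n) + 2 * t * (ip (s n) h - L h) + t\<^sup>2 * ip h h"
          using H[OF s, of n] H[OF h] L_add[OF s V_scale[OF h], of n t] L_scale[OF h, of t]
            ip_self_add[OF H[OF s] scale_mem[OF H[OF h]], of n t]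
          by (simp add: J_def ip_scale ip_scale_right scale_mem power2_eq_square algebra_simps)
        finally show ?thesis .
      qed
      then have "0 \<le> inverse (real (Suc n)) + 2 * t * (ip (s n) h - L h) + t\<^sup>2 * ip h h" for n
        using sJ[of n] by (smt (verit))
      moreover have "(\<lambda>n. inverse (real (Suc n)) + 2 * t * (ip (s n) h - L h) + t\<^sup>2 * ip h h)
          \<longlonglongrightarrow> 0 + 2 * t * (ip f h - L h) + t\<^sup>2 * ip h h"
        by (intro tendsto_intros LIMSEQ_inverse_real_of_nat ip_lim)
      ultimately show ?thesis by (auto intro: LIMSEQ_le_const)
    qed
    show ?thesis
    proof (cases "ip h h = 0")
      case True
      then show ?thesis using perturb[of 1] perturb[of "-1"] by simp
    next
      case False
      then have pos: "ip h h > 0" using ip_nonneg[OF H[OF h]] by linarith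
      \<comment> \<open>the minimiser in \<open>t\<close> of the quadratic\<close>
      define d t where "d = ip f h - L h" and "t = - d / ip h h"
      have "2 * t * d + t\<^sup>2 * ip h h = t * d"
        using pos by (simp add: t_def power2_eq_square)
      then have "0 \<le> t * d" using perturb[of t] by (simp add: d_def)
      then have "d * d \<le> 0" using pos by (simp add: t_def divide_le_0_iff zero_le_divide_iff)
      then have "d = 0" using not_real_square_gt_zero[of d] by linarith
      then show ?thesis by (simp add: d_def)
    qed
  qed
  then show ?thesis using fV by blast
qed

end

section \<open>Kernel mean embeddings\<close>

lemma prob_algebraD:
  assumes "Q \<in> space (prob_algebra X)"
  shows "prob_space Q" "sets Q = sets X" "space Q = space X"
    "f \<in> borel_measurable Q \<longleftrightarrow> f \<in> borel_measurable X"
  using assms sets_eq_imp_space_eq[of Q X] by (auto simp: space_prob_algebra cong: measurable_cong_sets)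

lemma integrable_bounded_prob_algebra:
  fixes f :: "'a \<Rightarrow> real"
  assumes Q: "Q \<in> space (prob_algebra X)"
    and f: "f \<in> borel_measurable X" "\<And>x. x \<in> space X \<Longrightarrow> \<bar>f x\<bar> \<le> B"
  shows "integrable Q f" "\<bar>\<integral>x. f x \<partial>Q\<bar> \<le> B"
proof -
  interpret Q: prob_space Q by (rule prob_algebraD[OF Q])
  have le: "x \<in> space Q \<Longrightarrow> norm (f x) \<le> B" for x using f(2) prob_algebraD(3)[OF Q] by simp
  show int: "integrable Q f"
    using le f(1) by (intro Q.integrable_const_bound[of _ B]) (auto simp: prob_algebraD(4)[OF Q])
  have "norm (\<integral>x. f x \<partial>Q) \<le> (\<integral>x. norm (f x) \<partial>Q)" by (rule integral_norm_bound)
  also have "\<dots> \<le> B" using le int by (intro Q.integral_le_const) auto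
  finally show "\<bar>\<integral>x. f x \<partial>Q\<bar> \<le> B" by simp
qed

locale bounded_rkhs = rkhs "space X" k H ip
  for X :: "'x measure" and k H ip +
  assumes kernel_measurable: "(\<lambda>z. k (fst z) (snd z)) \<in> borel_measurable (X \<Otimes>\<^sub>M X)"
    and kernel_bounded: "\<And>x y. x \<in> space X \<Longrightarrow> y \<in> space X \<Longrightarrow> \<bar>k x y\<bar> \<le> 1"
begin

abbreviation "\<mu> \<equiv> mean_embedding X k"
abbreviation "mmd_k \<equiv> mmd X k ip"

lemma kernel_sym: "x \<in> space X \<Longrightarrow> y \<in> space X \<Longrightarrow> k x y = k y x"
  using reproducing[OF kernel_mem, of x y] reproducing[OF kernel_mem, of y x]
    ip_sym[OF kernel_mem kernel_mem, of x y] by (simp add: kernel_section_def)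

lemma kernel_section_measurable:
  assumes "x \<in> space X"
  shows "kernel_section (space X) k x \<in> borel_measurable X"
proof -
  have "(\<lambda>y. k x y) \<in> borel_measurable X"
    using measurable_compose[OF measurable_Pair1'[OF assms] kernel_measurable] by simp
  then show ?thesis
    by (rule measurable_cong[THEN iffD1, rotated]) (simp add: kernel_section_def)
qed

lemma eval_le_norm: "f \<in> H \<Longrightarrow> x \<in> space X \<Longrightarrow> \<bar>f x\<bar> \<le> ip_norm ip f"
proof -
  assume f: "f \<in> H" and x: "x \<in> space X"
  have "sqrt (k x x) \<le> 1" using kernel_bounded[OF x x] by simp
  then show "\<bar>f x\<bar> \<le> ip_norm ip f"
    using eval_bound[OF f x] mult_left_mono[OF _ ip_norm_nonneg[OF f], of "sqrt (k x x)" 1] by linarith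
qed

text \<open>
  Integration against \<open>Q\<close> is additive only for measurable functions, so the functional to be
  represented lives on the measurable members of \<open>H\<close>. These form a closed subspace, since norm convergence implies pointwise convergence, and it contains
  every section of the kernel; testing the representer against the sections identifies it with the
  mean embedding.
\<close>
theorem mean_embedding_represents:
  assumes Q: "Q \<in> space (prob_algebra X)"
  shows "\<mu> Q \<in> H" "\<mu> Q \<in> borel_measurable X"
    and "\<And>h. h \<in> H \<Longrightarrow> h \<in> borel_measurable X \<Longrightarrow> ip (\<mu> Q) h = (\<integral>x. h x \<partial>Q)"
proof -
  define V where "V = {f \<in> H. f \<in> borel_measurable X}"
  have int: "integrable Q f" "\<bar>\<integral>x. f x \<partial>Q\<bar> \<le> ip_norm ip f" if "f \<in> V" for f
  proof -
    have f: "f \<in> H" "f \<in> borel_measurable X" using that by (auto simp: V_def)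
    show "integrable Q f" "\<bar>\<integral>x. f x \<partial>Q\<bar> \<le> ip_norm ip f"
      by (rule integrable_bounded_prob_algebra[OF Q f(2) eval_le_norm[OF f(1)]], assumption)+
  qed
  have "\<exists>f\<in>V. \<forall>h\<in>V. ip f h = (\<integral>x. h x \<partial>Q)"
  proof (rule Riesz_representation_subspace[where C = 1])
    show "V \<subseteq> H" "(\<lambda>x. 0) \<in> V" by (auto simp: V_def zero_mem)
    show "(\<lambda>x. f x + g x) \<in> V" if "f \<in> V" "g \<in> V" for f g
      using that by (auto simp: V_def add_mem)
    show "(\<lambda>x. c * f x) \<in> V" if "f \<in> V" for c f
      using that by (auto simp: V_def scale_mem)
    show "(\<integral>x. f x + g x \<partial>Q) = (\<integral>x. f x \<partial>Q) + (\<integral>x. g x \<partial>Q)" if "f \<in> V" "g \<in> V" for f g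
      using that by (simp add: int)
    show "(\<integral>x. c * f x \<partial>Q) = c * (\<integral>x. f x \<partial>Q)" if "f \<in> V" for c f
      by simp
    show "\<bar>\<integral>x. f x \<partial>Q\<bar> \<le> 1 * ip_norm ip f" if "f \<in> V" for f
      using int(2)[OF that] by simp
    fix s f assume s: "\<And>n::nat. s n \<in> V" and f: "f \<in> H"
      and lim: "(\<lambda>n. ip_norm ip (\<lambda>x. s n x - f x)) \<longlonglongrightarrow> 0"
    have "(\<lambda>n. s n x) \<longlonglongrightarrow> f x" if x: "x \<in> space X" for x
    proof (rule LIM_zero_cancel[OF Lim_null_comparison[OF always_eventually lim]], rule allI)
      show "norm (s n x - f x) \<le> ip_norm ip (\<lambda>x. s n x - f x)" for n
        using eval_le_norm[OF diff_mem[OF _ f] x] s[of n] by (auto simp: V_def)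
    qed
    then have "f \<in> borel_measurable X"
      using s by (intro borel_measurable_LIMSEQ_real[of X s f]) (auto simp: V_def)
    then show "f \<in> V" using f by (simp add: V_def)
  qed
  then obtain f where f: "f \<in> V" and rep: "\<And>h. h \<in> V \<Longrightarrow> ip f h = (\<integral>x. h x \<partial>Q)" by blast
  have "\<mu> Q = f"
  proof
    fix y
    show "\<mu> Q y = f y"
    proof (cases "y \<in> space X")
      case True
      have "f y = ip f (kernel_section (space X) k y)"
        using reproducing[OF _ True] f by (simp add: V_def)
      also have "\<dots> = (\<integral>x. kernel_section (space X) k y x \<partial>Q)"
        by (rule rep) (simp add: V_def kernel_mem True kernel_section_measurable)
      also have "\<dots> = \<mu> Q y"
        unfolding mean_embedding_def using True prob_algebraD(3)[OF Q]
        by (intro Bochner_Integration.integral_cong) (auto simp: kernel_section_def kernel_sym)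
      finally show ?thesis by simp
    next
      case False
      then show ?thesis
        using f functions_on by (simp add: V_def mean_embedding_def kernel_section_def)
    qed
  qed
  with f rep show "\<mu> Q \<in> H" "\<mu> Q \<in> borel_measurable X"
    "\<And>h. h \<in> H \<Longrightarrow> h \<in> borel_measurable X \<Longrightarrow> ip (\<mu> Q) h = (\<integral>x. h x \<partial>Q)"
    by (auto simp: V_def)
qed

lemma ip_mean_embedding:
  assumes "P \<in> space (prob_algebra X)" "Q \<in> space (prob_algebra X)"
  shows "ip (\<mu> P) (\<mu> Q) = (\<integral>x. \<mu> Q x \<partial>P)"
  using mean_embedding_represents assms by blast

lemma mean_embedding_bounded:
  assumes Q: "Q \<in> space (prob_algebra X)" and x: "x \<in> space X"
  shows "\<bar>\<mu> Q x\<bar> \<le> 1"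
proof -
  have "\<mu> Q x = ip (\<mu> Q) (kernel_section (space X) k x)"
    using reproducing[OF mean_embedding_represents(1)[OF Q] x] by simp
  also have "\<dots> = (\<integral>y. kernel_section (space X) k x y \<partial>Q)"
    by (rule mean_embedding_represents(3)[OF Q kernel_mem[OF x] kernel_section_measurable[OF x]])
  also have "\<bar>\<dots>\<bar> \<le> 1"
    using integrable_bounded_prob_algebra(2)[OF Q kernel_section_measurable[OF x], of 1] kernel_bounded[OF x]
    by (simp add: kernel_section_def)
  finally show ?thesis .
qed

lemma ip_mean_embedding_self_le: "Q \<in> space (prob_algebra X) \<Longrightarrow> ip (\<mu> Q) (\<mu> Q) \<le> 1"
  using integrable_bounded_prob_algebra(2)[OF _ mean_embedding_represents(2) mean_embedding_bounded, of Q Q]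
  by (simp add: ip_mean_embedding)

lemma mmd_power2:
  assumes "P \<in> space (prob_algebra X)" "Q \<in> space (prob_algebra X)"
  shows "(mmd_k P Q)\<^sup>2 = ip (\<lambda>y. \<mu> P y - \<mu> Q y) (\<lambda>y. \<mu> P y - \<mu> Q y)"
  unfolding mmd_def using assms by (intro ip_norm_power2 diff_mem mean_embedding_represents(1))

lemma mmd_power2_expand:
  assumes "P \<in> space (prob_algebra X)" "Q \<in> space (prob_algebra X)"
  shows "(mmd_k P Q)\<^sup>2 = ip (\<mu> P) (\<mu> P) - 2 * ip (\<mu> P) (\<mu> Q) + ip (\<mu> Q) (\<mu> Q)"
  using assms by (simp add: mmd_power2 ip_self_diff mean_embedding_represents(1))

lemma mmd_nonneg:
  assumes "P \<in> space (prob_algebra X)" "Q \<in> space (prob_algebra X)"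
  shows "0 \<le> mmd_k P Q"
  unfolding mmd_def using assms by (intro ip_norm_nonneg diff_mem mean_embedding_represents(1))

lemma mmd_power2_sym:
  assumes "P \<in> space (prob_algebra X)" "Q \<in> space (prob_algebra X)"
  shows "(mmd_k P Q)\<^sup>2 = (mmd_k Q P)\<^sup>2"
  using assms ip_sym[OF mean_embedding_represents(1) mean_embedding_represents(1), of P Q]
  by (simp add: mmd_power2_expand)

lemma mmd_power2_triangle:
  assumes "P \<in> space (prob_algebra X)" "Q \<in> space (prob_algebra X)" "R \<in> space (prob_algebra X)"
  shows "(mmd_k P R)\<^sup>2 \<le> 2 * (mmd_k P Q)\<^sup>2 + 2 * (mmd_k Q R)\<^sup>2"
  using ip_self_add_le[of "\<lambda>y. \<mu> P y - \<mu> Q y" "\<lambda>y. \<mu> Q y - \<mu> R y"] assms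
  by (simp add: mmd_power2 diff_mem mean_embedding_represents(1))

lemma mmd_power2_le:
  assumes "P \<in> space (prob_algebra X)" "Q \<in> space (prob_algebra X)"
  shows "(mmd_k P Q)\<^sup>2 \<le> 4"
proof -
  have "0 \<le> ip (\<lambda>y. \<mu> P y + \<mu> Q y) (\<lambda>y. \<mu> P y + \<mu> Q y)"
    using assms by (intro ip_nonneg add_mem mean_embedding_represents(1))
  then show ?thesis
    using assms ip_self_add[of "\<mu> P" "\<mu> Q"] ip_mean_embedding_self_le[OF assms(1)] ip_mean_embedding_self_le[OF assms(2)]
    by (simp add: mmd_power2_expand mean_embedding_represents(1))
qed

lemma mmd_self: "mmd_k P P = 0"
  using ip_scale[OF zero_mem zero_mem, of 0] by (simp add: mmd_def ip_norm_def)

end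

section \<open>The empirical measure of an independent sample\<close>

lemma empirical_measure_eq_distr:
  assumes n: "n \<ge> 1" and x: "x \<in> {1..n} \<rightarrow> space X"
  shows "empirical_measure X n x = distr (uniform_count_measure {1..n}) X x"
proof -
  let ?N = "distr (uniform_count_measure {1..n}) X x"
  have meas: "x \<in> uniform_count_measure {1..n} \<rightarrow>\<^sub>M X"
    using x by (auto simp: measurable_def space_uniform_count_measure sets_uniform_count_measure)
  have "(\<Sum>i\<in>{1..n}. emeasure (return X (x i)) A) / of_nat n = emeasure ?N A" if A: "A \<in> sets X" for A
  proof -
    have "(\<Sum>i\<in>{1..n}. emeasure (return X (x i)) A) = (\<Sum>i\<in>{1..n}. if x i \<in> A then 1 else 0)"
      using A by (intro sum.cong) (auto simp: indicator_def)
    also have "\<dots> = of_nat (card (x -` A \<inter> {1..n}))"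
      by (simp add: sum.If_cases vimage_def Int_commute)
    finally show ?thesis
      using n by (simp del: One_nat_def add: emeasure_distr[OF meas A] space_uniform_count_measure
          emeasure_uniform_count_measure divide_ennreal[symmetric] ennreal_of_nat_eq_real_of_nat)
  qed
  then have "empirical_measure X n x = measure_of (space X) (sets X) (emeasure ?N)"
    unfolding empirical_measure_def
    by (intro measure_of_eq[OF sets.space_closed]) (simp only: sets.sigma_sets_eq)
  also have "\<dots> = ?N" using measure_of_of_measure[of ?N] by (simp only: space_distr sets_distr)
  finally show ?thesis .
qed

lemma empirical_measure_prob:
  assumes n: "n \<ge> 1" and x: "x \<in> {1..n} \<rightarrow> space X"
  shows "empirical_measure X n x \<in> space (prob_algebra X)"
proof -
  have "prob_space (uniform_count_measure {1..n})"
    using n by (intro prob_space_uniform_count_measure) auto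
  moreover have "x \<in> uniform_count_measure {1..n} \<rightarrow>\<^sub>M X"
    using x by (auto simp: measurable_def space_uniform_count_measure sets_uniform_count_measure)
  ultimately show ?thesis
    unfolding empirical_measure_eq_distr[OF n x]
    by (simp add: space_prob_algebra prob_space.prob_space_distr)
qed

lemma integral_empirical_measure:
  fixes f :: "'a \<Rightarrow> real"
  assumes n: "n \<ge> 1" and x: "x \<in> {1..n} \<rightarrow> space X"
    and f: "f \<in> borel_measurable X"
  shows "(\<integral>y. f y \<partial>empirical_measure X n x) = (\<Sum>i\<in>{1..n}. f (x i)) / real n"
proof -
  have "x \<in> uniform_count_measure {1..n} \<rightarrow>\<^sub>M X"
    using x by (auto simp: measurable_def space_uniform_count_measure sets_uniform_count_measure)
  then show ?thesis
    unfolding empirical_measure_eq_distr[OF n x]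
    using f by (simp add: integral_distr integral_uniform_count_measure)
qed

lemma (in prob_space) indep_vars_pair:
  assumes "indep_vars N Y I" "i \<in> I" "j \<in> I" "i \<noteq> j"
  shows "indep_var (N i) (Y i) (N j) (Y j)"
proof -
  have "indep_var (N i) ((\<lambda>f. f i) \<circ> (\<lambda>\<omega>. restrict (\<lambda>i. Y i \<omega>) {i}))
      (N j) ((\<lambda>f. f j) \<circ> (\<lambda>\<omega>. restrict (\<lambda>i. Y i \<omega>) {j}))"
    using assms by (intro indep_var_compose[OF indep_var_restrict[OF assms(1), of "{i}" "{j}"]]) auto
  then show ?thesis by (simp add: comp_def)
qed

context bounded_rkhs
begin

lemma mean_embedding_eval:
  assumes Q: "Q \<in> space (prob_algebra X)" and x: "x \<in> space X"
  shows "\<mu> Q x = (\<integral>y. k x y \<partial>Q)"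
  unfolding mean_embedding_def using x prob_algebraD(3)[OF Q]
  by (intro Bochner_Integration.integral_cong) (auto simp: kernel_section_def kernel_sym)

text \<open>
  Written as a double sum over the sample, the squared discrepancy has for summand the kernel
  centred at its mean embedding.
\<close>
lemma mmd_power2_empirical:
  assumes Q: "Q \<in> space (prob_algebra X)" and n: "n \<ge> 1"
    and x: "x \<in> {1..n} \<rightarrow> space X"
  shows "(mmd_k (empirical_measure X n x) Q)\<^sup>2 =
    (\<Sum>i\<in>{1..n}. \<Sum>j\<in>{1..n}. k (x i) (x j) - \<mu> Q (x i) - \<mu> Q (x j) + ip (\<mu> Q) (\<mu> Q)) / (real n)\<^sup>2"
proof -
  let ?E = "empirical_measure X n x"
  note E = empirical_measure_prob[OF n x]
  note int = integral_empirical_measure[OF n x]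
  have emb: "\<mu> ?E (x i) = (\<Sum>j\<in>{1..n}. k (x i) (x j)) / real n" if i: "i \<in> {1..n}" for i
  proof -
    have xi: "x i \<in> space X" using x i by blast
    have "\<mu> ?E (x i) = (\<integral>y. kernel_section (space X) k (x i) y \<partial>?E)"
      using mean_embedding_represents(3)[OF E kernel_mem kernel_section_measurable, OF xi xi]
        reproducing[OF mean_embedding_represents(1)[OF E] xi] by simp
    also have "\<dots> = (\<Sum>j\<in>{1..n}. kernel_section (space X) k (x i) (x j)) / real n"
      by (rule int[OF kernel_section_measurable[OF xi]])
    also have "\<dots> = (\<Sum>j\<in>{1..n}. k (x i) (x j)) / real n"
      using x by (auto simp: kernel_section_def intro!: arg_cong[where f = "\<lambda>s. s / real n"] sum.cong)
    finally show ?thesis .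
  qed
  have EE: "ip (\<mu> ?E) (\<mu> ?E) = (\<Sum>i\<in>{1..n}. \<Sum>j\<in>{1..n}. k (x i) (x j)) / (real n)\<^sup>2"
    using int[OF mean_embedding_represents(2)[OF E]] emb
    by (simp del: One_nat_def add: ip_mean_embedding[OF E E] sum_divide_distrib power2_eq_square)
  have EQ: "ip (\<mu> ?E) (\<mu> Q) = (\<Sum>i\<in>{1..n}. \<mu> Q (x i)) / real n"
    using int[OF mean_embedding_represents(2)[OF Q]] by (simp add: ip_mean_embedding[OF E Q])
  have "(\<Sum>i\<in>{1..n}. \<Sum>j\<in>{1..n}. k (x i) (x j) - \<mu> Q (x i) - \<mu> Q (x j) + ip (\<mu> Q) (\<mu> Q))
      = (\<Sum>i\<in>{1..n}. \<Sum>j\<in>{1..n}. k (x i) (x j)) - 2 * real n * (\<Sum>i\<in>{1..n}. \<mu> Q (x i))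
        + (real n)\<^sup>2 * ip (\<mu> Q) (\<mu> Q)"
    by (simp add: sum.distrib sum_subtractf sum_distrib_left[symmetric] power2_eq_square)
  then show ?thesis
    using n unfolding mmd_power2_expand[OF E Q] EE EQ
    by (simp add: field_simps power2_eq_square)
qed

text \<open>
  Off the diagonal, independence makes the expectation of the centred kernel vanish. Only the \<open>n\<close>
  diagonal terms, each of expectation at most 1, survive the division by \<open>n\<^sup>2\<close>.
\<close>
theorem expectation_mmd_empirical_le:
  assumes M: "prob_space M" and Q: "Q \<in> space (prob_algebra X)" and n: "n \<ge> 1"
    and iid: "iid_sample M X Q {1..n} Xs"
  defines "d \<equiv> \<lambda>\<omega>. (mmd_k (empirical_measure X n (\<lambda>i. Xs i \<omega>)) Q)\<^sup>2"
  shows "integrable M d" "(\<integral>\<omega>. d \<omega> \<partial>M) \<le> 1 / real n"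
proof -
  interpret prob_space M by fact
  interpret Q: prob_space Q by (rule prob_algebraD(1)[OF Q])
  interpret QQ: pair_prob_space Q Q ..
  define q where "q = ip (\<mu> Q) (\<mu> Q)"
  define h where "h x y = k x y - \<mu> Q x - \<mu> Q y + q" for x y
  have indep: "indep_vars (\<lambda>_. X) Xs {1..n}"
    and distr: "\<And>i. i \<in> {1..n} \<Longrightarrow> distr M X (Xs i) = Q"
    using iid by (auto simp: iid_sample_def)
  have Xs[measurable]: "Xs i \<in> M \<rightarrow>\<^sub>M X" if "i \<in> {1..n}" for i
    using indep that by (auto simp: indep_vars_def)
  have Xs_space: "Xs i \<omega> \<in> space X" if "i \<in> {1..n}" "\<omega> \<in> space M" for i \<omega>
    using measurable_space[OF Xs] that by blast
  have k_meas: "(\<lambda>\<omega>. k (Xs i \<omega>) (Xs j \<omega>)) \<in> borel_measurable M" if "i \<in> {1..n}" "j \<in> {1..n}" for i j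
    using measurable_compose[OF measurable_Pair[OF Xs Xs] kernel_measurable, OF that] by simp
  have k_int: "integrable M (\<lambda>\<omega>. k (Xs i \<omega>) (Xs j \<omega>))" if "i \<in> {1..n}" "j \<in> {1..n}" for i j
    using that k_meas kernel_bounded Xs_space by (intro integrable_const_bound[of _ 1]) auto
  have emb_meas: "(\<lambda>\<omega>. \<mu> Q (Xs i \<omega>)) \<in> borel_measurable M" if "i \<in> {1..n}" for i
    by (rule measurable_compose[OF Xs[OF that] mean_embedding_represents(2)[OF Q]])
  have emb_int: "integrable M (\<lambda>\<omega>. \<mu> Q (Xs i \<omega>))" if "i \<in> {1..n}" for i
    using that emb_meas mean_embedding_bounded[OF Q] Xs_space
    by (intro integrable_const_bound[of _ 1]) auto
  have emb_E: "(\<integral>\<omega>. \<mu> Q (Xs i \<omega>) \<partial>M) = q" if i: "i \<in> {1..n}" for i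
    using integral_distr[OF Xs[OF i] mean_embedding_represents(2)[OF Q]]
    by (simp add: distr[OF i] q_def ip_mean_embedding[OF Q Q])
  have h_int: "integrable M (\<lambda>\<omega>. h (Xs i \<omega>) (Xs j \<omega>))" if "i \<in> {1..n}" "j \<in> {1..n}" for i j
    using k_int[OF that] emb_int that by (simp add: h_def)
  have h_E: "(\<integral>\<omega>. h (Xs i \<omega>) (Xs j \<omega>) \<partial>M) = (\<integral>\<omega>. k (Xs i \<omega>) (Xs j \<omega>) \<partial>M) - q"
    if "i \<in> {1..n}" "j \<in> {1..n}" for i j
    using k_int[OF that] emb_int emb_E that by (simp add: h_def prob_space)
  have k_E: "(\<integral>\<omega>. k (Xs i \<omega>) (Xs j \<omega>) \<partial>M) = q" if ij: "i \<in> {1..n}" "j \<in> {1..n}" "i \<noteq> j" for i j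
  proof -
    have sets_QQ: "sets (Q \<Otimes>\<^sub>M Q) = sets (X \<Otimes>\<^sub>M X)"
      by (intro sets_pair_measure_cong prob_algebraD(2)[OF Q])
    have meas: "(\<lambda>z. k (fst z) (snd z)) \<in> borel_measurable (Q \<Otimes>\<^sub>M Q)"
      using kernel_measurable by (simp add: measurable_cong_sets[OF sets_QQ refl])
    have int: "integrable (Q \<Otimes>\<^sub>M Q) (\<lambda>z. k (fst z) (snd z))"
      using kernel_bounded prob_algebraD(3)[OF Q] meas
      by (intro QQ.integrable_const_bound[of _ 1]) (auto simp: space_pair_measure)
    have "distr M (X \<Otimes>\<^sub>M X) (\<lambda>\<omega>. (Xs i \<omega>, Xs j \<omega>)) = Q \<Otimes>\<^sub>M Q"
      using indep_vars_pair[OF indep ij] distr ij by (simp add: indep_var_distribution_eq)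
    then have "(\<integral>\<omega>. k (Xs i \<omega>) (Xs j \<omega>) \<partial>M) = (\<integral>z. k (fst z) (snd z) \<partial>(Q \<Otimes>\<^sub>M Q))"
      using integral_distr[OF measurable_Pair[OF Xs Xs] kernel_measurable, OF ij(1,2)] by simp
    also have "\<dots> = (\<integral>x. (\<integral>y. k x y \<partial>Q) \<partial>Q)"
      using QQ.integral_fst'[OF int] by simp
    also have "\<dots> = (\<integral>x. \<mu> Q x \<partial>Q)"
      using mean_embedding_eval[OF Q] prob_algebraD(3)[OF Q]
      by (intro Bochner_Integration.integral_cong) auto
    finally show ?thesis by (simp add: q_def ip_mean_embedding[OF Q Q])
  qed
  have h_bound: "(\<integral>\<omega>. h (Xs i \<omega>) (Xs j \<omega>) \<partial>M) \<le> (if i = j then 1 else 0)"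
    if ij: "i \<in> {1..n}" "j \<in> {1..n}" for i j
  proof (cases "i = j")
    case True
    have "(\<integral>\<omega>. k (Xs i \<omega>) (Xs i \<omega>) \<partial>M) \<le> 1"
      using k_int[OF ij(1,1)] kernel_bounded[OF Xs_space Xs_space, OF ij(1) _ ij(1)]
      by (intro integral_le_const) (auto simp: abs_le_iff)
    moreover have "0 \<le> q" unfolding q_def by (intro ip_nonneg mean_embedding_represents(1) Q)
    ultimately show ?thesis using h_E[OF ij] True by simp
  qed (use h_E[OF ij] k_E[OF ij] in simp)
  have d_eq: "d \<omega> = (\<Sum>i\<in>{1..n}. \<Sum>j\<in>{1..n}. h (Xs i \<omega>) (Xs j \<omega>)) / (real n)\<^sup>2" if "\<omega> \<in> space M" for \<omega>
    unfolding d_def h_def q_def by (rule mmd_power2_empirical[OF Q n]) (use Xs_space that in blast)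
  have int_sum: "integrable M (\<lambda>\<omega>. (\<Sum>i\<in>{1..n}. \<Sum>j\<in>{1..n}. h (Xs i \<omega>) (Xs j \<omega>)) / (real n)\<^sup>2)"
    by (intro integrable_divide Bochner_Integration.integrable_sum h_int)
  then show "integrable M d"
    by (rule Bochner_Integration.integrable_cong[OF refl, THEN iffD2, rotated]) (rule d_eq)
  have "(\<integral>\<omega>. d \<omega> \<partial>M)
      = (\<integral>\<omega>. (\<Sum>i\<in>{1..n}. \<Sum>j\<in>{1..n}. h (Xs i \<omega>) (Xs j \<omega>)) / (real n)\<^sup>2 \<partial>M)"
    by (rule Bochner_Integration.integral_cong[OF refl d_eq])
  also have "\<dots> = (\<Sum>i\<in>{1..n}. \<Sum>j\<in>{1..n}. \<integral>\<omega>. h (Xs i \<omega>) (Xs j \<omega>) \<partial>M) / (real n)\<^sup>2"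
  proof -
    have "(\<integral>\<omega>. (\<Sum>i\<in>{1..n}. \<Sum>j\<in>{1..n}. h (Xs i \<omega>) (Xs j \<omega>)) \<partial>M)
        = (\<Sum>i\<in>{1..n}. \<integral>\<omega>. (\<Sum>j\<in>{1..n}. h (Xs i \<omega>) (Xs j \<omega>)) \<partial>M)"
      by (intro Bochner_Integration.integral_sum Bochner_Integration.integrable_sum h_int)
    also have "\<dots> = (\<Sum>i\<in>{1..n}. \<Sum>j\<in>{1..n}. \<integral>\<omega>. h (Xs i \<omega>) (Xs j \<omega>) \<partial>M)"
      by (intro sum.cong refl Bochner_Integration.integral_sum h_int)
    finally show ?thesis by simp
  qed
  also have "\<dots> \<le> (\<Sum>i\<in>{1..n}. \<Sum>j\<in>{1..n}. if i = j then 1 else 0) / (real n)\<^sup>2"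
    by (intro divide_right_mono sum_mono h_bound) auto
  also have "\<dots> = 1 / real n" using n by (simp add: power2_eq_square)
  finally show "(\<integral>\<omega>. d \<omega> \<partial>M) \<le> 1 / real n" .
qed

end

section \<open>Relative entropy and exponential tilting\<close>

lemma KL_nonneg_prob:
  assumes \<pi>: "prob_space \<pi>" and \<rho>: "prob_space \<rho>" "sets \<rho> = sets \<pi>"
  shows "0 \<le> KL \<rho> \<pi>"
proof (cases "absolutely_continuous \<pi> \<rho> \<and> integrable \<rho> (entropy_density (exp 1) \<pi> \<rho>)")
  case True
  interpret \<pi>: prob_space \<pi> by fact
  interpret \<pi>: information_space \<pi> "exp 1" by standard simp
  interpret \<rho>: prob_space \<rho> by fact
  obtain D where D: "D \<in> borel_measurable \<pi>" "AE x in \<pi>. RN_deriv \<pi> \<rho> x = ennreal (D x)"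
      "AE x in \<rho>. 0 < D x" "\<And>x. 0 \<le> D x"
    using \<pi>.real_RN_deriv[OF \<rho>.finite_measure_axioms] True \<rho>(2) by blast
  have "density \<pi> (RN_deriv \<pi> \<rho>) = \<rho>"
    using \<pi>.density_RN_deriv True \<rho>(2) by blast
  moreover have "density \<pi> (RN_deriv \<pi> \<rho>) = density \<pi> D"
    using D by (intro density_cong) auto
  ultimately have \<rho>_eq: "\<rho> = density \<pi> D" by simp
  have "AE x in \<rho>. RN_deriv \<pi> \<rho> x = ennreal (D x)"
    using absolutely_continuous_AE[OF \<rho>(2)] True D(2) by blast
  then have "AE x in \<rho>. entropy_density (exp 1) \<pi> \<rho> x = log (exp 1) (D x)"
    using D(4) by (auto simp: entropy_density_def)
  moreover have "entropy_density (exp 1) \<pi> \<rho> \<in> borel_measurable \<rho>" "D \<in> borel_measurable \<rho>"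
    using D(1) by (auto simp: measurable_cong_sets[OF \<rho>(2) refl])
  ultimately have "integrable \<rho> (\<lambda>x. log (exp 1) (D x))"
    using True by (subst integrable_cong_AE[symmetric, of "entropy_density (exp 1) \<pi> \<rho>"]) auto
  then have "integrable \<pi> (\<lambda>x. D x * log (exp 1) (D x))"
    using D by (subst integrable_real_density[symmetric]) (auto simp: \<rho>_eq[symmetric])
  then have "0 \<le> KL_divergence (exp 1) \<pi> \<rho>"
    using \<pi>.KL_nonneg[of D] D \<rho>(1) by (simp add: \<rho>_eq[symmetric])
  then show ?thesis using True by (simp add: KL_def)
qed (auto simp: KL_def)

text \<open>
  The density \<open>exp (- W)\<close> never vanishes, so the reference measures \<open>\<pi>\<close> and its tilting have
  the same null sets, and the log-densities of \<open>\<rho>\<close> against them differ by \<open>W\<close>.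
\<close>
theorem KL_exp_density:
  fixes W :: "'a \<Rightarrow> real"
  assumes \<pi>: "prob_space \<pi>" and \<rho>: "prob_space \<rho>" "sets \<rho> = sets \<pi>"
    and W[measurable]: "W \<in> borel_measurable \<pi>" and W_int: "integrable \<rho> W"
  shows "KL \<rho> (density \<pi> (\<lambda>x. ennreal (exp (- W x)))) = KL \<rho> \<pi> + ereal (\<integral>x. W x \<partial>\<rho>)"
proof -
  let ?post = "density \<pi> (\<lambda>x. ennreal (exp (- W x)))"
  interpret \<pi>: prob_space \<pi> by fact
  interpret \<rho>: prob_space \<rho> by fact
  interpret post: sigma_finite_measure ?post
    by (subst \<pi>.sigma_finite_iff_density_finite) auto
  have sets_post: "sets \<rho> = sets ?post" using \<rho>(2) by simp
  have "A \<in> null_sets ?post \<longleftrightarrow> A \<in> null_sets \<pi>" for A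
  proof (cases "A \<in> sets \<pi>")
    case True
    then show ?thesis by (simp add: AE_iff_null_sets AE_density)
  next
    case False
    then show ?thesis by (auto simp: null_sets_def)
  qed
  then have "null_sets ?post = null_sets \<pi>" by blast
  then have ac_iff: "absolutely_continuous ?post \<rho> \<longleftrightarrow> absolutely_continuous \<pi> \<rho>"
    by (simp add: absolutely_continuous_def)
  show ?thesis
  proof (cases "absolutely_continuous \<pi> \<rho>")
    case ac: True
    obtain D where D[measurable]: "D \<in> borel_measurable \<pi>"
      and D': "AE x in \<pi>. RN_deriv \<pi> \<rho> x = ennreal (D x)" "AE x in \<rho>. 0 < D x" "\<And>x. 0 \<le> D x"
      using \<pi>.real_RN_deriv[OF \<rho>.finite_measure_axioms ac \<rho>(2)] by blast
    have \<rho>_eq: "\<rho> = density \<pi> D"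
    proof -
      have "density \<pi> (RN_deriv \<pi> \<rho>) = density \<pi> D" using D' by (intro density_cong) auto
      then show ?thesis using \<pi>.density_RN_deriv[OF ac \<rho>(2)] by simp
    qed
    have "density ?post (\<lambda>x. ennreal (D x * exp (W x))) = density \<pi> D"
      using D'(3) by (subst density_density_eq)
        (auto intro!: density_cong simp: ennreal_mult[symmetric] exp_minus field_simps)
    then have "AE x in ?post. ennreal (D x * exp (W x)) = RN_deriv ?post \<rho> x"
      by (intro post.RN_deriv_unique) (auto simp: \<rho>_eq[symmetric])
    then have post_RN: "AE x in \<rho>. ennreal (D x * exp (W x)) = RN_deriv ?post \<rho> x"
      using absolutely_continuous_AE[OF sets_post] ac ac_iff by blast
    have RN: "AE x in \<rho>. RN_deriv \<pi> \<rho> x = ennreal (D x)"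
      using absolutely_continuous_AE[OF \<rho>(2) ac] D'(1) by blast
    have ae: "AE x in \<rho>. entropy_density (exp 1) ?post \<rho> x = entropy_density (exp 1) \<pi> \<rho> x + W x"
      using RN post_RN D'(2)
    proof eventually_elim
      case (elim x)
      then show ?case
        by (simp add: entropy_density_def log_def ln_mult elim(2)[symmetric])
    qed
    have [measurable]: "entropy_density (exp 1) ?post \<rho> \<in> borel_measurable \<rho>"
      "entropy_density (exp 1) \<pi> \<rho> \<in> borel_measurable \<rho>" "W \<in> borel_measurable \<rho>"
      using measurable_entropy_density[of _ ?post \<rho>] by (auto simp: measurable_cong_sets[OF \<rho>(2) refl])
    have "integrable \<rho> (entropy_density (exp 1) ?post \<rho>)
        \<longleftrightarrow> integrable \<rho> (\<lambda>x. entropy_density (exp 1) \<pi> \<rho> x + W x)"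
      by (rule integrable_cong_AE[OF _ _ ae]) auto
    also have "\<dots> \<longleftrightarrow> integrable \<rho> (entropy_density (exp 1) \<pi> \<rho>)"
    proof
      assume "integrable \<rho> (\<lambda>x. entropy_density (exp 1) \<pi> \<rho> x + W x)"
      from Bochner_Integration.integrable_diff[OF this W_int]
      show "integrable \<rho> (entropy_density (exp 1) \<pi> \<rho>)" by simp
    next
      assume "integrable \<rho> (entropy_density (exp 1) \<pi> \<rho>)"
      from Bochner_Integration.integrable_add[OF this W_int]
      show "integrable \<rho> (\<lambda>x. entropy_density (exp 1) \<pi> \<rho> x + W x)" .
    qed
    finally have int_iff: "integrable \<rho> (entropy_density (exp 1) ?post \<rho>)
        \<longleftrightarrow> integrable \<rho> (entropy_density (exp 1) \<pi> \<rho>)" .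
    show ?thesis
    proof (cases "integrable \<rho> (entropy_density (exp 1) \<pi> \<rho>)")
      case True
      have "KL_divergence (exp 1) ?post \<rho> = (\<integral>x. entropy_density (exp 1) \<pi> \<rho> x + W x \<partial>\<rho>)"
        unfolding KL_divergence_def by (rule integral_cong_AE[OF _ _ ae]) auto
      also have "\<dots> = KL_divergence (exp 1) \<pi> \<rho> + (\<integral>x. W x \<partial>\<rho>)"
        using True W_int by (simp add: KL_divergence_def)
      finally show ?thesis using True ac by (simp add: KL_def ac_iff int_iff)
    qed (simp add: KL_def int_iff)
  qed (simp add: KL_def ac_iff)
qed

text \<open>
  In \<open>KL \<rho> post\<close> the normalising constant of the posterior contributes a constant, so the
  approximation minimises \<open>\<beta> * (\<integral>\<theta>. V \<theta> \<partial>\<rho>) + KL \<rho> \<pi>\<close> over the variational set. The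
  divergence of the minimiser from the prior is then dropped, being nonnegative.
\<close>
lemma variational_approximation_risk_le:
  fixes V :: "'t \<Rightarrow> real"
  assumes \<pi>: "\<pi> \<in> space (prob_algebra T)" and F: "F \<subseteq> space (prob_algebra T)"
    and V: "V \<in> borel_measurable T" "\<And>\<theta>. \<theta> \<in> space T \<Longrightarrow> \<bar>V \<theta>\<bar> \<le> B"
    and \<beta>: "\<beta> > 0"
    and \<rho>: "variational_approximation F
      (density \<pi> (\<lambda>\<theta>. ennreal (exp (- \<beta> * V \<theta>) / (\<integral>\<theta>'. exp (- \<beta> * V \<theta>') \<partial>\<pi>)))) \<rho>"
    and \<rho>': "\<rho>' \<in> F" "KL \<rho>' \<pi> \<le> ereal c"
  shows "(\<integral>\<theta>. V \<theta> \<partial>\<rho>) \<le> (\<integral>\<theta>. V \<theta> \<partial>\<rho>') + c / \<beta>"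
proof -
  interpret \<pi>: prob_space \<pi> by (rule prob_algebraD[OF \<pi>])
  define Z where "Z = (\<integral>\<theta>. exp (- \<beta> * V \<theta>) \<partial>\<pi>)"
  define W where "W \<theta> = \<beta> * V \<theta> + ln Z" for \<theta>
  define post where "post = density \<pi> (\<lambda>\<theta>. ennreal (exp (- W \<theta>)))"
  have exp_le: "exp (- \<beta> * V \<theta>) \<le> exp (\<beta> * B)" and exp_ge: "exp (- \<beta> * B) \<le> exp (- \<beta> * V \<theta>)"
    if "\<theta> \<in> space T" for \<theta>
  proof -
    have "- B \<le> V \<theta>" "V \<theta> \<le> B" using V(2)[OF that] by auto
    then have "- (\<beta> * B) \<le> \<beta> * V \<theta>" "\<beta> * V \<theta> \<le> \<beta> * B"
      using \<beta> mult_left_mono[of "- B" "V \<theta>" \<beta>] by simp_all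
    then show "exp (- \<beta> * V \<theta>) \<le> exp (\<beta> * B)" "exp (- \<beta> * B) \<le> exp (- \<beta> * V \<theta>)"
      by simp_all
  qed
  have "integrable \<pi> (\<lambda>\<theta>. exp (- \<beta> * V \<theta>))"
    using exp_le V(1) by (intro integrable_bounded_prob_algebra(1)[OF \<pi>, of _ "exp (\<beta> * B)"]) auto
  then have "exp (- \<beta> * B) \<le> Z"
    unfolding Z_def using exp_ge prob_algebraD(3)[OF \<pi>] by (intro \<pi>.integral_ge_const) auto
  then have Z: "Z > 0" using less_le_trans[OF exp_gt_zero] by blast
  have post_eq: "density \<pi> (\<lambda>\<theta>. ennreal (exp (- \<beta> * V \<theta>) / (\<integral>\<theta>'. exp (- \<beta> * V \<theta>') \<partial>\<pi>))) = post"
  proof -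
    have "exp (- W \<theta>) = exp (- \<beta> * V \<theta>) / Z" for \<theta>
      using exp_diff[of "- \<beta> * V \<theta>" "ln Z"] exp_ln[OF Z] by (simp add: W_def)
    then show ?thesis by (simp only: post_def Z_def)
  qed
  have KL_post: "KL \<nu> post = KL \<nu> \<pi> + ereal (\<beta> * (\<integral>\<theta>. V \<theta> \<partial>\<nu>) + ln Z)" if \<nu>: "\<nu> \<in> F" for \<nu>
  proof -
    have \<nu>: "\<nu> \<in> space (prob_algebra T)" using \<nu> F by blast
    interpret \<nu>: prob_space \<nu> by (rule prob_algebraD[OF \<nu>])
    have int: "integrable \<nu> V" by (rule integrable_bounded_prob_algebra(1)[OF \<nu> V])
    have "(\<integral>\<theta>. W \<theta> \<partial>\<nu>) = \<beta> * (\<integral>\<theta>. V \<theta> \<partial>\<nu>) + ln Z"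
      using int by (simp add: W_def \<nu>.prob_space)
    moreover have "integrable \<nu> W" using int by (simp add: W_def[abs_def])
    moreover have "W \<in> borel_measurable \<pi>"
      using V(1) by (simp add: W_def[abs_def] prob_algebraD(4)[OF \<pi>])
    ultimately show ?thesis
      unfolding post_def
      using KL_exp_density[OF \<pi>.prob_space_axioms \<nu>.prob_space_axioms] prob_algebraD(2)[OF \<nu>] prob_algebraD(2)[OF \<pi>]
      by simp
  qed
  have \<rho>F: "\<rho> \<in> F" and min: "KL \<rho> post \<le> KL \<rho>' post"
    using \<rho> \<rho>'(1) unfolding post_eq variational_approximation_def is_arg_min_def by (auto simp: not_less)
  have "\<rho> \<in> space (prob_algebra T)" using \<rho>F F by blast
  then have "0 \<le> KL \<rho> \<pi>"
    using KL_nonneg_prob[OF \<pi>.prob_space_axioms] prob_algebraD(1,2)[of \<rho> T] prob_algebraD(2)[OF \<pi>] by simp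
  then have "0 + ereal (\<beta> * (\<integral>\<theta>. V \<theta> \<partial>\<rho>) + ln Z) \<le> KL \<rho> post"
    unfolding KL_post[OF \<rho>F] by (rule add_right_mono)
  also have "\<dots> \<le> KL \<rho>' post" by (rule min)
  also have "\<dots> \<le> ereal c + ereal (\<beta> * (\<integral>\<theta>. V \<theta> \<partial>\<rho>') + ln Z)"
    unfolding KL_post[OF \<rho>'(1)] by (rule add_right_mono[OF \<rho>'(2)])
  finally have "\<beta> * (\<integral>\<theta>. V \<theta> \<partial>\<rho>) \<le> c + \<beta> * (\<integral>\<theta>. V \<theta> \<partial>\<rho>')" by simp
  then show ?thesis using \<beta> by (simp add: field_simps)
qed

section \<open>Risk bound and concentration\<close>

lemma integral_prob_kernel_measurable:
  fixes f :: "_ \<Rightarrow> real"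
  assumes "\<rho> \<in> M \<rightarrow>\<^sub>M prob_algebra T" "f \<in> borel_measurable T"
  shows "(\<lambda>\<omega>. \<integral>\<theta>. f \<theta> \<partial>\<rho> \<omega>) \<in> borel_measurable M"
  by (rule measurable_compose[OF measurable_prob_algebraD[OF assms(1)]
        integral_measurable_subprob_algebra[OF assms(2)]])

text \<open>
  The triangle inequality is used in the form \<open>(a + b)\<^sup>2 \<le> 2 * a\<^sup>2 + 2 * b\<^sup>2\<close> three times: to pass
  from \<open>P0\<close> to the empirical measure, back again under the competitor \<open>\<rho>'\<close>, and from \<open>P0\<close> to
  \<open>P \<theta>s\<close>. Hence the factor 8, and the remainder \<open>(8 + 2 + 6) / n\<close>, collecting the prior
  mass, the divergence term and the empirical error.
\<close>
theorem (in bounded_rkhs) variational_risk_bound: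
  assumes P0: "P0 \<in> space (prob_algebra X)"
    and model: "\<And>\<theta>. \<theta> \<in> space T \<Longrightarrow> P \<theta> \<in> space (prob_algebra X)"
    and model_measurable:
      "\<And>Q. Q \<in> space (prob_algebra X) \<Longrightarrow> (\<lambda>\<theta>. mmd_k (P \<theta>) Q) \<in> borel_measurable T"
    and \<pi>: "\<pi> \<in> space (prob_algebra T)" and F: "F \<subseteq> space (prob_algebra T)"
    and \<theta>s: "\<theta>s \<in> space T" and M: "prob_space M"
    and n: "n \<ge> 1" and \<beta>: "\<beta> > 0" and iid: "iid_sample M X P0 {1..n} Xs"
    and \<rho>: "\<rho> \<in> M \<rightarrow>\<^sub>M prob_algebra T"
    and variational: "\<And>\<omega>. \<omega> \<in> space M \<Longrightarrow> variational_approximation F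
      (mmd_posterior X k ip P \<pi> \<beta> (empirical_measure X n (\<lambda>i. Xs i \<omega>))) (\<rho> \<omega>)"
    and mass: "extended_prior_mass X k ip P \<theta>s \<pi> F n \<beta>"
  shows "(\<integral>\<omega>. (\<integral>\<theta>. (mmd_k (P \<theta>) P0)\<^sup>2 \<partial>\<rho> \<omega>) \<partial>M)
    \<le> 8 * (mmd_k (P \<theta>s) P0)\<^sup>2 + 16 / real n"
proof -
  interpret prob_space M by fact
  define E where "E \<omega> = empirical_measure X n (\<lambda>i. Xs i \<omega>)" for \<omega>
  define d where "d \<omega> = (mmd_k (E \<omega>) P0)\<^sup>2" for \<omega>
  define r where "r \<omega> = (\<integral>\<theta>. (mmd_k (P \<theta>) P0)\<^sup>2 \<partial>\<rho> \<omega>)" for \<omega>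
  have E: "E \<omega> \<in> space (prob_algebra X)" if "\<omega> \<in> space M" for \<omega>
  proof -
    have "Xs i \<in> M \<rightarrow>\<^sub>M X" if "i \<in> {1..n}" for i
      using iid that by (auto simp: iid_sample_def indep_vars_def)
    then have "(\<lambda>i. Xs i \<omega>) \<in> {1..n} \<rightarrow> space X"
      using \<open>\<omega> \<in> space M\<close> measurable_space by fast
    then show ?thesis unfolding E_def by (rule empirical_measure_prob[OF n])
  qed
  have sq_meas: "(\<lambda>\<theta>. (mmd_k (P \<theta>) Q)\<^sup>2) \<in> borel_measurable T"
    if "Q \<in> space (prob_algebra X)" for Q
    using model_measurable[OF that] by simp
  have sq_int: "integrable \<nu> (\<lambda>\<theta>. (mmd_k (P \<theta>) Q)\<^sup>2)"
    if "\<nu> \<in> space (prob_algebra T)" "Q \<in> space (prob_algebra X)" for \<nu> Q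
    using that mmd_power2_le[OF model] sq_meas
    by (intro integrable_bounded_prob_algebra(1)[where B = 4]) auto
  have change: "(\<integral>\<theta>. (mmd_k (P \<theta>) R)\<^sup>2 \<partial>\<nu>) \<le> 2 * (\<integral>\<theta>. (mmd_k (P \<theta>) Q)\<^sup>2 \<partial>\<nu>) + 2 * (mmd_k Q R)\<^sup>2"
    if \<nu>: "\<nu> \<in> space (prob_algebra T)" and Q: "Q \<in> space (prob_algebra X)"
      and R: "R \<in> space (prob_algebra X)" for \<nu> Q R
  proof -
    interpret \<nu>: prob_space \<nu> by (rule prob_algebraD[OF \<nu>])
    have "(\<integral>\<theta>. (mmd_k (P \<theta>) R)\<^sup>2 \<partial>\<nu>) \<le> (\<integral>\<theta>. 2 * (mmd_k (P \<theta>) Q)\<^sup>2 + 2 * (mmd_k Q R)\<^sup>2 \<partial>\<nu>)"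
      using mmd_power2_triangle[OF model Q R] prob_algebraD(3)[OF \<nu>] sq_int[OF \<nu> Q] sq_int[OF \<nu> R]
      by (intro integral_mono) auto
    also have "\<dots> = 2 * (\<integral>\<theta>. (mmd_k (P \<theta>) Q)\<^sup>2 \<partial>\<nu>) + 2 * (mmd_k Q R)\<^sup>2"
      using sq_int[OF \<nu> Q] by (simp add: \<nu>.prob_space)
    finally show ?thesis .
  qed
  obtain \<rho>' where \<rho>'F: "\<rho>' \<in> F" and mass: "(\<integral>\<theta>. (mmd_k (P \<theta>) (P \<theta>s))\<^sup>2 \<partial>\<rho>') \<le> 1 / real n"
    and div: "KL \<rho>' \<pi> \<le> ereal (\<beta> / real n)"
    using mass unfolding extended_prior_mass_def by blast
  have \<rho>': "\<rho>' \<in> space (prob_algebra T)" using \<rho>'F F by blast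
  have pointwise: "r \<omega> \<le> 8 * (mmd_k (P \<theta>s) P0)\<^sup>2 + 10 / real n + 6 * d \<omega>" if \<omega>: "\<omega> \<in> space M" for \<omega>
  proof -
    have \<rho>\<omega>: "\<rho> \<omega> \<in> space (prob_algebra T)" using measurable_space[OF \<rho> \<omega>] .
    have "r \<omega> \<le> 2 * (\<integral>\<theta>. (mmd_k (P \<theta>) (E \<omega>))\<^sup>2 \<partial>\<rho> \<omega>) + 2 * d \<omega>"
      unfolding r_def d_def by (rule change[OF \<rho>\<omega> E[OF \<omega>] P0])
    moreover have "(\<integral>\<theta>. (mmd_k (P \<theta>) (E \<omega>))\<^sup>2 \<partial>\<rho> \<omega>)
        \<le> (\<integral>\<theta>. (mmd_k (P \<theta>) (E \<omega>))\<^sup>2 \<partial>\<rho>') + \<beta> / real n / \<beta>"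
      using variational[OF \<omega>] unfolding mmd_posterior_def E_def[symmetric]
      by (intro variational_approximation_risk_le[OF \<pi> F sq_meas[OF E[OF \<omega>]] _ \<beta> _ \<rho>'F div, of 4])
        (auto simp: mmd_power2_le model E \<omega>)
    moreover have "(\<integral>\<theta>. (mmd_k (P \<theta>) (E \<omega>))\<^sup>2 \<partial>\<rho>')
        \<le> 2 * (\<integral>\<theta>. (mmd_k (P \<theta>) P0)\<^sup>2 \<partial>\<rho>') + 2 * d \<omega>"
      using change[OF \<rho>' P0 E[OF \<omega>]] mmd_power2_sym[OF P0 E[OF \<omega>]] by (simp add: d_def)
    moreover have "(\<integral>\<theta>. (mmd_k (P \<theta>) P0)\<^sup>2 \<partial>\<rho>') \<le> 2 * (1 / real n) + 2 * (mmd_k (P \<theta>s) P0)\<^sup>2"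
      using change[OF \<rho>' model[OF \<theta>s] P0] mass by linarith
    ultimately show ?thesis using \<beta> by simp
  qed
  have d_int: "integrable M d" and d_E: "(\<integral>\<omega>. d \<omega> \<partial>M) \<le> 1 / real n"
    using expectation_mmd_empirical_le[OF M P0 n iid] unfolding d_def[abs_def] E_def by blast+
  have r_int: "integrable M r"
  proof (rule integrable_const_bound[of _ 4])
    show "r \<in> borel_measurable M"
      unfolding r_def[abs_def] by (rule integral_prob_kernel_measurable[OF \<rho> sq_meas[OF P0]])
    have "\<bar>r \<omega>\<bar> \<le> 4" if \<omega>: "\<omega> \<in> space M" for \<omega>
      unfolding r_def
      using mmd_power2_le[OF model P0]
      by (intro integrable_bounded_prob_algebra(2)[OF measurable_space[OF \<rho> \<omega>] sq_meas[OF P0]]) auto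
    then show "AE \<omega> in M. norm (r \<omega>) \<le> 4" by auto
  qed
  have "(\<integral>\<omega>. r \<omega> \<partial>M) \<le> (\<integral>\<omega>. 8 * (mmd_k (P \<theta>s) P0)\<^sup>2 + 10 / real n + 6 * d \<omega> \<partial>M)"
    using r_int d_int pointwise by (intro integral_mono) auto
  also have "\<dots> = 8 * (mmd_k (P \<theta>s) P0)\<^sup>2 + 10 / real n + 6 * (\<integral>\<omega>. d \<omega> \<partial>M)"
    using d_int by (simp add: prob_space)
  also have "\<dots> \<le> 8 * (mmd_k (P \<theta>s) P0)\<^sup>2 + 16 / real n"
    using d_E by simp
  finally show ?thesis unfolding r_def .
qed

text \<open>
  Markov's inequality is applied twice: under the random distribution it bounds the mass of the
  event by the second moment over the squared threshold, and under \<open>M\<close> it bounds the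
  probability that this quotient exceeds \<open>\<epsilon>\<close>.
\<close>
lemma contraction_in_probability:
  fixes f :: "'t \<Rightarrow> real" and m :: "nat \<Rightarrow> real"
  assumes M: "prob_space M"
    and \<rho>: "\<And>n. n \<ge> 1 \<Longrightarrow> \<rho> n \<in> M \<rightarrow>\<^sub>M prob_algebra T"
    and f: "f \<in> borel_measurable T" "\<And>\<theta>. \<theta> \<in> space T \<Longrightarrow> (f \<theta>)\<^sup>2 \<le> B"
    and moment: "\<And>n. n \<ge> 1 \<Longrightarrow> (\<integral>\<omega>. (\<integral>\<theta>. (f \<theta>)\<^sup>2 \<partial>\<rho> n \<omega>) \<partial>M) \<le> c / real n"
    and m: "filterlim m at_top sequentially" and \<epsilon>: "\<epsilon> > 0"
  shows "(\<lambda>n. measure M {\<omega>\<in>space M. measure (\<rho> n \<omega>)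
      {\<theta>\<in>space T. f \<theta> > m n * real n powr (- 1 / 2)} > \<epsilon>}) \<longlonglongrightarrow> 0"
proof -
  interpret prob_space M by fact
  have f2: "(\<lambda>\<theta>. (f \<theta>)\<^sup>2) \<in> borel_measurable T" using f(1) by simp
  have f2_bound: "\<bar>(f \<theta>)\<^sup>2\<bar> \<le> B" if "\<theta> \<in> space T" for \<theta> using f(2)[OF that] by simp
  have bound: "measure M {\<omega>\<in>space M. measure (\<rho> n \<omega>) {\<theta>\<in>space T. f \<theta> > m n * real n powr (- 1 / 2)} > \<epsilon>}
      \<le> (c / \<epsilon>) * inverse (m n ^ 2)" if n: "n \<ge> 1" and mn: "m n > 0" for n
  proof -
    define a where "a = m n * real n powr (- 1 / 2)"
    define r where "r \<omega> = (\<integral>\<theta>. (f \<theta>)\<^sup>2 \<partial>\<rho> n \<omega>)" for \<omega>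
    have a: "a > 0" using n mn by (simp add: a_def)
    have "(real n powr (- 1 / 2))\<^sup>2 = 1 / real n"
      using n powr_add[of "real n" "- 1 / 2" "- 1 / 2"] powr_neg_one[of "real n"]
      by (simp add: power2_eq_square)
    then have a2: "a\<^sup>2 = (m n)\<^sup>2 / real n" by (simp add: a_def power_mult_distrib)
    have r_nonneg: "0 \<le> r \<omega>" for \<omega> by (simp add: r_def)
    have r_meas: "r \<in> borel_measurable M"
      unfolding r_def[abs_def] by (rule integral_prob_kernel_measurable[OF \<rho>[OF n] f2])
    have "\<bar>r \<omega>\<bar> \<le> B" if "\<omega> \<in> space M" for \<omega>
      unfolding r_def
      by (rule integrable_bounded_prob_algebra(2)[OF measurable_space[OF \<rho>[OF n] that] f2 f2_bound])
    then have r_int: "integrable M r" using r_meas by (intro integrable_const_bound[of _ B]) auto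
    have inner: "measure (\<rho> n \<omega>) {\<theta>\<in>space T. f \<theta> > a} \<le> r \<omega> / a\<^sup>2" if \<omega>: "\<omega> \<in> space M" for \<omega>
    proof -
      have \<rho>\<omega>: "\<rho> n \<omega> \<in> space (prob_algebra T)" by (rule measurable_space[OF \<rho>[OF n] \<omega>])
      interpret \<rho>: prob_space "\<rho> n \<omega>" by (rule prob_algebraD[OF \<rho>\<omega>])
      note [simp] = prob_algebraD(2,3)[OF \<rho>\<omega>]
      have "{\<theta>\<in>space T. f \<theta> > a} \<subseteq> {\<theta>\<in>space (\<rho> n \<omega>). (f \<theta>)\<^sup>2 \<ge> a\<^sup>2}"
        using a by (auto intro: power_mono)
      moreover have "{\<theta>\<in>space (\<rho> n \<omega>). (f \<theta>)\<^sup>2 \<ge> a\<^sup>2} \<in> sets (\<rho> n \<omega>)"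
        using f2 by simp
      ultimately have "measure (\<rho> n \<omega>) {\<theta>\<in>space T. f \<theta> > a}
          \<le> measure (\<rho> n \<omega>) {\<theta>\<in>space (\<rho> n \<omega>). (f \<theta>)\<^sup>2 \<ge> a\<^sup>2}"
        by (rule \<rho>.finite_measure_mono)
      also have "\<dots> \<le> r \<omega> / a\<^sup>2"
        unfolding r_def using a integrable_bounded_prob_algebra(1)[OF \<rho>\<omega> f2 f2_bound]
        by (intro integral_Markov_inequality_measure[where A = "{}"]) auto
      finally show ?thesis .
    qed
    have "{\<omega>\<in>space M. measure (\<rho> n \<omega>) {\<theta>\<in>space T. f \<theta> > a} > \<epsilon>} \<subseteq> {\<omega>\<in>space M. r \<omega> \<ge> \<epsilon> * a\<^sup>2}"
    proof (intro subsetI CollectI conjI; elim CollectE conjE)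
      fix \<omega> assume \<omega>: "\<omega> \<in> space M" and "measure (\<rho> n \<omega>) {\<theta>\<in>space T. f \<theta> > a} > \<epsilon>"
      then have "\<epsilon> \<le> r \<omega> / a\<^sup>2" using inner[OF \<omega>] by linarith
      then show "\<epsilon> * a\<^sup>2 \<le> r \<omega>" using a by (simp add: field_simps)
    qed
    then have "measure M {\<omega>\<in>space M. measure (\<rho> n \<omega>) {\<theta>\<in>space T. f \<theta> > a} > \<epsilon>}
        \<le> measure M {\<omega>\<in>space M. r \<omega> \<ge> \<epsilon> * a\<^sup>2}"
      by (rule finite_measure_mono) (use r_meas in simp)
    also have "\<dots> \<le> (\<integral>\<omega>. r \<omega> \<partial>M) / (\<epsilon> * a\<^sup>2)"
      using r_int r_nonneg \<epsilon> a by (intro integral_Markov_inequality_measure[where A = "{}"]) auto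
    also have "\<dots> \<le> (c / real n) / (\<epsilon> * a\<^sup>2)"
      using moment[OF n] \<epsilon> a unfolding r_def by (intro divide_right_mono) auto
    also have "\<dots> = (c / \<epsilon>) * inverse (m n ^ 2)"
      using n mn \<epsilon> by (simp add: a2 field_simps)
    finally show ?thesis unfolding a_def .
  qed
  have "\<forall>\<^sub>F n in sequentially. norm (measure M {\<omega>\<in>space M. measure (\<rho> n \<omega>)
      {\<theta>\<in>space T. f \<theta> > m n * real n powr (- 1 / 2)} > \<epsilon>}) \<le> (c / \<epsilon>) * inverse (m n ^ 2)"
    using eventually_ge_at_top[of 1] filterlim_at_top_dense[THEN iffD1, OF m, rule_format, of 0]
  proof eventually_elim
    case (elim n)
    then show ?case using bound[OF elim] by simp
  qed
  moreover have "(\<lambda>n. (c / \<epsilon>) * inverse (m n ^ 2)) \<longlonglongrightarrow> (c / \<epsilon>) * 0"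
    by (intro tendsto_mult_left tendsto_inverse_0_at_top filterlim_pow_at_top m) simp
  ultimately show ?thesis by (auto intro: Lim_null_comparison)
qed

theorem theorem4:
  fixes X :: "'x measure"
    and k :: "'x \<Rightarrow> 'x \<Rightarrow> real"
    and H :: "('x \<Rightarrow> real) set"
    and ip :: "('x \<Rightarrow> real) \<Rightarrow> ('x \<Rightarrow> real) \<Rightarrow> real"
    and T :: "'t measure"
    and P :: "'t \<Rightarrow> 'x measure"
    and P0 :: "'x measure"
    and \<pi> :: "'t measure"
    and F :: "'t measure set"
    and \<theta>s :: 't
    and M :: "'w measure"
    and Xs :: "nat \<Rightarrow> 'w \<Rightarrow> 'x"
  defines "D \<equiv> mmd X k ip"
  assumes kernel_measurable: "(\<lambda>z. k (fst z) (snd z)) \<in> borel_measurable (X \<Otimes>\<^sub>M X)"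
    and kernel_ispd: "integrally_strictly_positive_definite X k"
    and kernel_bounded: "\<And>x y. x \<in> space X \<Longrightarrow> y \<in> space X \<Longrightarrow> \<bar>k x y\<bar> \<le> 1"
    and H_k: "rkhs (space X) k H ip"
    and P0: "P0 \<in> space (prob_algebra X)"
    and model: "\<And>\<theta>. \<theta> \<in> space T \<Longrightarrow> P \<theta> \<in> space (prob_algebra X)"
    and model_measurable:
      "\<And>Q. Q \<in> space (prob_algebra X) \<Longrightarrow> (\<lambda>\<theta>. D (P \<theta>) Q) \<in> borel_measurable T"
    and prior: "\<pi> \<in> space (prob_algebra T)"
    and variational_set: "F \<subseteq> space (prob_algebra T)"
    and theta_star: "is_arg_min (\<lambda>\<theta>. D (P \<theta>) P0) (\<lambda>\<theta>. \<theta> \<in> space T) \<theta>s"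
    and sample_space: "prob_space M"
  shows
    "(\<forall>n \<beta> \<rho>. n \<ge> 1 \<and> \<beta> > 0 \<and>
        iid_sample M X P0 {1..n} Xs \<and>
        \<rho> \<in> M \<rightarrow>\<^sub>M prob_algebra T \<and>
        (\<forall>\<omega>\<in>space M. variational_approximation F
           (mmd_posterior X k ip P \<pi> \<beta> (empirical_measure X n (\<lambda>i. Xs i \<omega>))) (\<rho> \<omega>)) \<and>
        extended_prior_mass X k ip P \<theta>s \<pi> F n \<beta>
      \<longrightarrow>
        (\<integral>\<omega>. (\<integral>\<theta>. (D (P \<theta>) P0)\<^sup>2 \<partial>\<rho> \<omega>) \<partial>M)
          \<le> 8 * (INF \<theta>\<in>space T. (D (P \<theta>) P0)\<^sup>2) + 16 / real n)
     \<and>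
     (\<forall>\<beta> \<rho>. 
        iid_sample M X P0 {1..} Xs \<and>
        P0 \<in> P ` space T \<and>
        (\<forall>n\<ge>1. \<beta> n > 0 \<and>
          \<rho> n \<in> M \<rightarrow>\<^sub>M prob_algebra T \<and>
          (\<forall>\<omega>\<in>space M. variational_approximation F
             (mmd_posterior X k ip P \<pi> (\<beta> n) (empirical_measure X n (\<lambda>i. Xs i \<omega>))) (\<rho> n \<omega>)) \<and>
          extended_prior_mass X k ip P \<theta>s \<pi> F n (\<beta> n) \<and>
          prior_mass X k ip P \<theta>s \<pi> n (\<beta> n))
      \<longrightarrow>
        (\<forall>m :: nat \<Rightarrow> real. filterlim m at_top sequentially \<longrightarrow>
          (\<forall>\<epsilon>>0. (\<lambda>n. measure M {\<omega>\<in>space M.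
              measure (\<rho> n \<omega>) {\<theta>\<in>space T. D (P \<theta>) P0 > m n * real n powr (- 1 / 2)} > \<epsilon>})
            \<longlonglongrightarrow> 0)))"
proof -
  interpret bounded_rkhs X k H ip
    using H_k kernel_measurable kernel_bounded by (simp add: bounded_rkhs_def bounded_rkhs_axioms_def)
  note D_measurable = model_measurable[unfolded D_def]
  have \<theta>s: "\<theta>s \<in> space T" and min: "\<And>\<theta>. \<theta> \<in> space T \<Longrightarrow> D (P \<theta>s) P0 \<le> D (P \<theta>) P0"
    using theta_star by (auto simp: is_arg_min_def not_less)
  note risk_bound = variational_risk_bound[OF P0 model D_measurable prior variational_set \<theta>s sample_space,
      folded D_def]
  have inf: "(D (P \<theta>s) P0)\<^sup>2 \<le> (INF \<theta>\<in>space T. (D (P \<theta>) P0)\<^sup>2)"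
    using \<theta>s min mmd_nonneg[OF model[OF \<theta>s] P0]
    by (intro cINF_greatest) (auto simp: D_def intro: power_mono)
  show ?thesis
  proof (intro conjI allI impI, goal_cases)
    case (1 n \<beta> \<rho>)
    then have "(\<integral>\<omega>. (\<integral>\<theta>. (D (P \<theta>) P0)\<^sup>2 \<partial>\<rho> \<omega>) \<partial>M) \<le> 8 * (D (P \<theta>s) P0)\<^sup>2 + 16 / real n"
      by (intro risk_bound) auto
    then show ?case using inf by linarith
  next
    case (2 \<beta> \<rho> m \<epsilon>)
    then obtain \<theta>0 where "\<theta>0 \<in> space T" "P0 = P \<theta>0" by blast
    then have "D (P \<theta>s) P0 \<le> 0" using min[of \<theta>0] by (simp add: D_def mmd_self)
    then have zero: "D (P \<theta>s) P0 = 0" using mmd_nonneg[OF model[OF \<theta>s] P0] by (simp add: D_def)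
    have iid: "iid_sample M X P0 {1..n} Xs" for n
      using 2 prob_space.indep_vars_subset[OF sample_space, of "\<lambda>_. X" Xs "{1..}" "{1..n}"]
      by (auto simp: iid_sample_def)
    show ?case
    proof (rule contraction_in_probability[OF sample_space])
      show "(\<integral>\<omega>. (\<integral>\<theta>. (D (P \<theta>) P0)\<^sup>2 \<partial>\<rho> n \<omega>) \<partial>M) \<le> 16 / real n" if n: "n \<ge> 1" for n
      proof -
        have "(\<integral>\<omega>. (\<integral>\<theta>. (D (P \<theta>) P0)\<^sup>2 \<partial>\<rho> n \<omega>) \<partial>M)
            \<le> 8 * (D (P \<theta>s) P0)\<^sup>2 + 16 / real n"
          by (intro risk_bound[where \<beta> = "\<beta> n"]) (use 2 n iid in auto)
        then show ?thesis by (simp add: zero)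
      qed
      show "(D (P \<theta>) P0)\<^sup>2 \<le> 4" if "\<theta> \<in> space T" for \<theta>
        using mmd_power2_le[OF model[OF that] P0] by (simp add: D_def)
    qed (use 2 model_measurable[OF P0] in auto)
  qed
qed

end
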